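(* Let $D$ be the formal derivative associated with the grammar $G=\{u\rightarrow uv,\ v\rightarrow 2u\}$. Then for every integer $n\ge0$, $$D^n(u)=\sum_{k=0}^{\lfloor n/2\rfloor}a(n+1,k)\,u^{k+1}v^{n-2k}.$$
   Context: For a grammar $G$ over a set of independent commuting indeterminates, the formal derivative $D$ is the linear derivation (satisfying the Leibniz rule) on polynomials in these indeterminates sending each indeterminate to its image under the substitution rule; here $D$ is the derivation of $\mathbb{Q}[u,v]$ with $D(u)=uv$ and $D(v)=2u$. For a permutation $\pi$ of $\{1,\dots,n\}$ let $\mathrm{des}(\pi)=\#\{1\le i\le n-1:\pi(i)>\pi(i+1)\}$ and let $A_n(x)=\sum_{\pi\in\mathfrak S_n}x^{\mathrm{des}(\pi)}$ be the Eulerian polynomial. For $n\ge1$, the numbers $a(n,k)$ (the $\gamma$-vector of the type $A$ Coxeter complex) are the uniquely determined coefficients in $A_n(x)=\sum_{k=0}^{\lfloor (n-1)/2\rfloor}a(n,k)x^k(1+x)^{n-1-2k}$ (such an expansion exists). *)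

theory Defs
  imports
    "HOL-Library.Poly_Mapping"
    "HOL-Combinatorics.Permutations"
    "HOL-Computational_Algebra.Polynomial"
begin

text \<open>
  Polynomials with rational coefficients in commuting indeterminates indexed by \<^typ>\<open>'x\<close>:
  a finitely supported map from exponent vectors to coefficients. The multiplication of
  \<^theory>\<open>HOL-Library.Poly_Mapping\<close> is convolution, so this is the usual polynomial ring.
\<close>

type_synonym 'x qpoly = "('x \<Rightarrow>\<^sub>0 nat) \<Rightarrow>\<^sub>0 rat"

definition indet :: "'x \<Rightarrow> 'x qpoly" where
  "indet x = Poly_Mapping.single (Poly_Mapping.single x 1) 1"

definition cst :: "rat \<Rightarrow> 'x qpoly" where
  "cst c = Poly_Mapping.single 0 c"

text \<open>A grammar assigns to each indeterminate the polynomial that is substituted for it.\<close>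

definition is_formal_derivative :: "('x \<Rightarrow> 'x qpoly) \<Rightarrow> ('x qpoly \<Rightarrow> 'x qpoly) \<Rightarrow> bool" where
  "is_formal_derivative g D \<longleftrightarrow>
     (\<forall>p q. D (p + q) = D p + D q) \<and>
     (\<forall>c p. D (cst c * p) = cst c * D p) \<and>
     (\<forall>p q. D (p * q) = D p * q + p * D q) \<and>
     (\<forall>x. D (indet x) = g x)"

lemma poly_mapping_sum_monomials:
  "(\<Sum>m\<in>Poly_Mapping.keys p. Poly_Mapping.single m (Poly_Mapping.lookup p m)) = p"
  by (rule poly_mapping_eqI) (simp add: lookup_sum lookup_single when_def in_keys_iff)

definition mono_deriv :: "('x \<Rightarrow> 'x qpoly) \<Rightarrow> ('x \<Rightarrow>\<^sub>0 nat) \<Rightarrow> 'x qpoly" where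
  "mono_deriv g m = (\<Sum>x\<in>Poly_Mapping.keys m.
     Poly_Mapping.single (m - Poly_Mapping.single x 1) (of_nat (Poly_Mapping.lookup m x)) * g x)"

lemma mono_deriv_superset:
  assumes "finite S" "Poly_Mapping.keys m \<subseteq> S"
  shows "mono_deriv g m = (\<Sum>x\<in>S.
     Poly_Mapping.single (m - Poly_Mapping.single x 1) (of_nat (Poly_Mapping.lookup m x)) * g x)"
  unfolding mono_deriv_def
  by (rule sum.mono_neutral_left) (use assms in \<open>auto simp: in_keys_iff\<close>)

lemma single_diff_shift:
  "Poly_Mapping.single (m - Poly_Mapping.single x 1) (of_nat (Poly_Mapping.lookup m x))
     * Poly_Mapping.single m' (1::rat)
   = Poly_Mapping.single (m + m' - Poly_Mapping.single x (1::nat)) (of_nat (Poly_Mapping.lookup m x))"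
proof (cases "Poly_Mapping.lookup m x = 0")
  case False
  have "m - Poly_Mapping.single x 1 + m' = m + m' - Poly_Mapping.single x (1::nat)"
    by (rule poly_mapping_eqI)
       (use False in \<open>auto simp: lookup_add lookup_minus lookup_single when_def\<close>)
  then show ?thesis by (simp add: mult_single)
qed simp

lemma mono_deriv_add:
  "mono_deriv g (m + m') = mono_deriv g m * Poly_Mapping.single m' 1
     + Poly_Mapping.single m 1 * mono_deriv g m'"
proof -
  let ?S = "Poly_Mapping.keys m \<union> Poly_Mapping.keys m'"
  have fin: "finite ?S" by simp
  have sub: "Poly_Mapping.keys (m + m') \<subseteq> ?S" by (rule Poly_Mapping.keys_add)
  have "mono_deriv g m * Poly_Mapping.single m' 1 + Poly_Mapping.single m 1 * mono_deriv g m' =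
     (\<Sum>x\<in>?S. (Poly_Mapping.single (m - Poly_Mapping.single x 1) (of_nat (Poly_Mapping.lookup m x))
          * Poly_Mapping.single m' 1) * g x
       + (Poly_Mapping.single (m' - Poly_Mapping.single x 1) (of_nat (Poly_Mapping.lookup m' x))
          * Poly_Mapping.single m 1) * g x)"
    by (simp add: mono_deriv_superset[OF fin] sum_distrib_left sum_distrib_right sum.distrib
        mult.assoc mult.commute mult.left_commute)
  also have "\<dots> = mono_deriv g (m + m')"
    unfolding mono_deriv_superset[OF fin sub] single_diff_shift
    by (intro sum.cong refl)
       (simp add: add.commute[of m' m] lookup_add single_add flip: distrib_right)
  finally show ?thesis ..
qed

definition expl_deriv :: "('x \<Rightarrow> 'x qpoly) \<Rightarrow> 'x qpoly \<Rightarrow> 'x qpoly" where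
  "expl_deriv g p = (\<Sum>m\<in>Poly_Mapping.keys p. cst (Poly_Mapping.lookup p m) * mono_deriv g m)"

lemma expl_deriv_superset:
  assumes "finite S" "Poly_Mapping.keys p \<subseteq> S"
  shows "expl_deriv g p = (\<Sum>m\<in>S. cst (Poly_Mapping.lookup p m) * mono_deriv g m)"
  unfolding expl_deriv_def
  by (rule sum.mono_neutral_left) (use assms in \<open>auto simp: in_keys_iff cst_def\<close>)

lemma expl_deriv_add: "expl_deriv g (p + q) = expl_deriv g p + expl_deriv g q"
proof -
  let ?S = "Poly_Mapping.keys p \<union> Poly_Mapping.keys q"
  have fin: "finite ?S" by simp
  have sub: "Poly_Mapping.keys (p + q) \<subseteq> ?S" by (rule Poly_Mapping.keys_add)
  show ?thesis
    unfolding expl_deriv_superset[OF fin sub]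
    by (simp add: expl_deriv_superset[OF fin] lookup_add cst_def single_add distrib_right sum.distrib)
qed

lemma expl_deriv_single:
  "expl_deriv g (Poly_Mapping.single m c) = cst c * mono_deriv g m"
  by (cases "c = 0") (auto simp: expl_deriv_def cst_def)

lemma qpoly_induct [case_names zero add]:
  fixes p :: "'x qpoly"
  assumes "P 0" "\<And>m c q. P q \<Longrightarrow> P (Poly_Mapping.single m c + q)"
  shows "P p"
proof -
  have "P (\<Sum>m\<in>S. Poly_Mapping.single m (Poly_Mapping.lookup p m))" if "finite S" for S
    using that by (induction S) (use assms in auto)
  from this[of "Poly_Mapping.keys p"] show ?thesis
    by (simp add: poly_mapping_sum_monomials)
qed

lemma is_formal_derivative_expl_deriv: "is_formal_derivative g (expl_deriv g)"
proof -
  have 0: "expl_deriv g 0 = 0" by (simp add: expl_deriv_def)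
  have cst_mult: "cst (a * b) = cst a * (cst b :: 'x qpoly)" for a b
    by (simp add: cst_def mult_single)
  have cm: "Poly_Mapping.single m c = cst c * Poly_Mapping.single m 1" for m :: "'x \<Rightarrow>\<^sub>0 nat" and c
    by (simp add: cst_def mult_single)
  have mono: "expl_deriv g (Poly_Mapping.single m c * Poly_Mapping.single m' c') =
      expl_deriv g (Poly_Mapping.single m c) * Poly_Mapping.single m' c' +
      Poly_Mapping.single m c * expl_deriv g (Poly_Mapping.single m' c')" for m c m' c'
    unfolding mult_single expl_deriv_single mono_deriv_add cst_mult
    by (simp only: cm[of m c] cm[of m' c'] distrib_left distrib_right mult.assoc mult.commute mult.left_commute)
  have half: "expl_deriv g (Poly_Mapping.single m c * q) =
      expl_deriv g (Poly_Mapping.single m c) * q + Poly_Mapping.single m c * expl_deriv g q" for m c q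
    by (induction q rule: qpoly_induct)
       (simp_all add: 0 distrib_left expl_deriv_add mono algebra_simps)
  have leib: "expl_deriv g (p * q) = expl_deriv g p * q + p * expl_deriv g q" for p q
    by (induction p rule: qpoly_induct)
       (simp_all add: 0 distrib_left distrib_right expl_deriv_add half mult.assoc add_ac)
  have c0: "expl_deriv g (cst c) = 0" for c
    unfolding cst_def expl_deriv_single by (simp add: mono_deriv_def)
  have X: "expl_deriv g (indet x) = g x" for x
    unfolding indet_def expl_deriv_single
    by (simp add: mono_deriv_def cst_def)
  show ?thesis
    unfolding is_formal_derivative_def by (simp add: expl_deriv_add leib c0 X)
qed

lemma is_formal_derivative_unique:
  assumes "is_formal_derivative g D" "is_formal_derivative g E"
  shows "D = E"
proof
  fix p :: "'a qpoly"
  note D = assms(1)[unfolded is_formal_derivative_def]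
  note E = assms(2)[unfolded is_formal_derivative_def]
  have one: "cst 1 = (1 :: 'a qpoly)" by (simp add: cst_def)
  have D1: "D 1 = 0" using D by (metis add_cancel_right_right mult_1 mult_1_right)
  have E1: "E 1 = 0" using E by (metis add_cancel_right_right mult_1 mult_1_right)
  have D0: "D 0 = 0" using D by (metis add_cancel_right_right add_0)
  have E0: "E 0 = 0" using E by (metis add_cancel_right_right add_0)
  have pow: "D (Poly_Mapping.single (Poly_Mapping.single x k) 1) =
             E (Poly_Mapping.single (Poly_Mapping.single x k) 1)" for x k
  proof (induction k)
    case 0
    then show ?case using D1 E1 by simp
  next
    case (Suc k)
    have "Poly_Mapping.single (Poly_Mapping.single x (Suc k)) 1 =
        indet x * Poly_Mapping.single (Poly_Mapping.single x k) (1::rat)"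
      by (simp add: indet_def mult_single flip: single_add)
    then show ?case using D E Suc by simp
  qed
  have prod: "D (Poly_Mapping.single (\<Sum>x\<in>S. Poly_Mapping.single x (f x)) 1) =
              E (Poly_Mapping.single (\<Sum>x\<in>S. Poly_Mapping.single x (f x)) 1)" if "finite S" for S f
    using that
  proof (induction S)
    case empty
    then show ?case using D1 E1 by simp
  next
    case (insert x S)
    have "Poly_Mapping.single (\<Sum>x\<in>insert x S. Poly_Mapping.single x (f x)) 1 =
        Poly_Mapping.single (Poly_Mapping.single x (f x)) 1 *
        Poly_Mapping.single (\<Sum>x\<in>S. Poly_Mapping.single x (f x)) (1::rat)"
      using insert by (simp add: mult_single)
    then show ?case using D E insert pow by simp
  qed
  have mono: "D (Poly_Mapping.single m 1) = E (Poly_Mapping.single m 1)" for m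
    using prod[of "Poly_Mapping.keys m" "Poly_Mapping.lookup m"]
    by (simp add: poly_mapping_sum_monomials)
  have mono': "D (Poly_Mapping.single m c) = E (Poly_Mapping.single m c)" for m c
  proof -
    have "Poly_Mapping.single m c = cst c * Poly_Mapping.single m 1"
      by (simp add: cst_def mult_single)
    then show ?thesis using D E mono by metis
  qed
  show "D p = E p"
    by (induction p rule: qpoly_induct) (use D E D0 E0 mono' in simp_all)
qed

text \<open>
  The derivation is uniquely determined by the grammar, see \<open>formal_derivative_ex1\<close> and
  \<open>is_formal_derivative_formal_derivative\<close> below.
\<close>

definition formal_derivative :: "('x \<Rightarrow> 'x qpoly) \<Rightarrow> 'x qpoly \<Rightarrow> 'x qpoly" where
  "formal_derivative g = (THE D. is_formal_derivative g D)"

lemma formal_derivative_ex1: "\<exists>!D. is_formal_derivative g D"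
  using is_formal_derivative_expl_deriv is_formal_derivative_unique by blast

lemma is_formal_derivative_formal_derivative: "is_formal_derivative g (formal_derivative g)"
  unfolding formal_derivative_def by (rule theI'[OF formal_derivative_ex1])

datatype uv = U | V

fun grammar_G :: "uv \<Rightarrow> uv qpoly" where
  "grammar_G U = indet U * indet V"
| "grammar_G V = cst 2 * indet U"

definition des :: "nat \<Rightarrow> (nat \<Rightarrow> nat) \<Rightarrow> nat" where
  "des n p = card {i \<in> {1..<n}. p i > p (i + 1)}"

definition eulerian_poly :: "nat \<Rightarrow> rat poly" where
  "eulerian_poly n = (\<Sum>p | p permutes {1..n}. monom 1 (des n p))"

text \<open>
  The coefficients beyond the range of summation are set to 0, which makes the
  coefficient function unique. For \<open>f = eulerian_poly n\<close> and \<open>d = n - 1\<close> it also exists,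
  see \<open>gamma_A_ex1\<close> below.
\<close>

definition is_gamma_expansion :: "nat \<Rightarrow> rat poly \<Rightarrow> (nat \<Rightarrow> rat) \<Rightarrow> bool" where
  "is_gamma_expansion d f c \<longleftrightarrow>
     f = (\<Sum>k\<le>d div 2. smult (c k) ([:0, 1:] ^ k * [:1, 1:] ^ (d - 2 * k))) \<and>
     (\<forall>k>d div 2. c k = 0)"

definition gamma_A :: "nat \<Rightarrow> nat \<Rightarrow> rat" where
  "gamma_A n = (THE c. is_gamma_expansion (n - 1) (eulerian_poly n) c)"

lemma is_gamma_expansion_unique:
  assumes "is_gamma_expansion d f a" "is_gamma_expansion d f b"
  shows "a = b"
proof
  fix k
  define t where "t j = [:0, 1:] ^ j * [:1, 1 :: rat:] ^ (d - 2 * j)" for j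
  have xp: "[:0, 1 :: rat:] ^ j = monom 1 j" for j by (simp add: monom_altdef)
  have ct: "coeff (t j) i = (if i < j then 0 else coeff ([:1, 1:] ^ (d - 2 * j)) (i - j))" for i j
    by (simp add: t_def xp coeff_monom_mult)
  have e: "(\<Sum>k\<le>d div 2. smult (a k) (t k)) = (\<Sum>k\<le>d div 2. smult (b k) (t k))"
    using assms unfolding is_gamma_expansion_def t_def by metis
  show "a k = b k"
  proof (induction k rule: less_induct)
    case (less k)
    show ?case
    proof (cases "k \<le> d div 2")
      case False
      then show ?thesis using assms by (simp add: is_gamma_expansion_def)
    next
      case True
      have *: "coeff (\<Sum>j\<le>d div 2. smult (c j) (t j)) k = (\<Sum>j<k. c j * coeff (t j) k) + c k" for c
      proof -
        have "coeff (t k) k = 1"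
          by (simp add: ct flip: poly_0_coeff_0)
        moreover have "coeff (\<Sum>j\<le>d div 2. smult (c j) (t j)) k = (\<Sum>j\<le>k. c j * coeff (t j) k)"
          unfolding coeff_sum coeff_smult
          by (rule sum.mono_neutral_right) (use True in \<open>auto simp: ct\<close>)
        ultimately show ?thesis by (simp flip: lessThan_Suc_atMost)
      qed
      have "(\<Sum>j<k. a j * coeff (t j) k) = (\<Sum>j<k. b j * coeff (t j) k)"
        by (rule sum.cong) (simp_all add: less)
      with *[of a] *[of b] e show ?thesis by simp
    qed
  qed
qed

lemma is_gamma_expansion_exists:
  assumes "degree f \<le> d" "\<And>i. i \<le> d \<Longrightarrow> coeff f i = coeff f (d - i)"
  shows "\<exists>c. is_gamma_expansion d f c"
  using assms
proof (induction d arbitrary: f rule: less_induct)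
  case (less d)
  define a where "a = coeff f 0"
  show ?case
  proof (cases "d \<le> 1")
    case True
    have "f = smult a ([:1, 1:] ^ d)"
    proof (cases "d = 0")
      case True
      then have "f = [:a:]" using less.prems(1) by (metis a_def le_zero_eq degree_eq_zeroE coeff_pCons_0)
      then show ?thesis using True by simp
    next
      case False
      then have d: "d = 1" using \<open>d \<le> 1\<close> by simp
      have "f = [:a, coeff f 1:]"
      proof (rule poly_eqI)
        fix i
        show "coeff f i = coeff [:a, coeff f 1:] i"
          using less.prems(1) d by (auto simp: a_def coeff_pCons coeff_eq_0 split: nat.split)
      qed
      moreover have "coeff f 1 = a" using less.prems(2)[of 0] d by (simp add: a_def)
      ultimately show ?thesis using d by simp
    qed
    then have "is_gamma_expansion d f (\<lambda>k. if k = 0 then a else 0)"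
      using True by (auto simp: is_gamma_expansion_def)
    then show ?thesis by blast
  next
    case False
    define B where "B = [:1, 1 :: rat:] ^ d"
    have degB: "degree B = d" by (simp add: B_def degree_power_eq)
    have cB: "coeff B i = coeff B (d - i)" if "i \<le> d" for i
    proof -
      have "reflect_poly B = B" unfolding B_def by (simp add: reflect_poly_power reflect_poly_pCons)
      then show ?thesis using that degB by (metis coeff_reflect_poly linorder_not_less)
    qed
    have B0: "coeff B 0 = 1" by (simp add: B_def flip: poly_0_coeff_0)
    define h where "h = f - smult a B"
    have degh: "degree h \<le> d" unfolding h_def
      using less.prems(1) degB by (intro degree_diff_le) (auto intro: order.trans[OF degree_smult_le])
    have ch: "coeff h i = coeff h (d - i)" if "i \<le> d" for i
      using less.prems(2)[OF that] cB[OF that] by (simp add: h_def)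
    have h0: "coeff h 0 = 0" by (simp add: h_def a_def B0)
    obtain q where q: "h = pCons 0 q" using h0 by (metis coeff_pCons_0 pCons_cases)
    have cq: "coeff q i = coeff h (Suc i)" for i by (simp add: q)
    have "coeff q i = 0" if "i > d - 2" for i
    proof (cases "Suc i = d")
      case True
      then show ?thesis using ch[of 0] h0 by (simp add: cq)
    next
      case False
      then show ?thesis using that degh by (auto simp: cq intro!: coeff_eq_0)
    qed
    then have degq: "degree q \<le> d - 2" by (intro degree_le) auto
    have "coeff q i = coeff q (d - 2 - i)" if "i \<le> d - 2" for i
    proof -
      have "d - Suc i = Suc (d - 2 - i)" using that False by simp
      then show ?thesis using ch[of "Suc i"] that False by (simp add: cq)
    qed
    with less.IH[of "d - 2" q] degq False obtain c where c: "is_gamma_expansion (d - 2) q c" by auto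
    have dd: "d div 2 = Suc ((d - 2) div 2)" using False by auto
    define c' where "c' k = (case k of 0 \<Rightarrow> a | Suc j \<Rightarrow> c j)" for k
    have "f = smult a B + [:0, 1:] * q" by (simp add: h_def flip: q)
    also have "\<dots> = (\<Sum>k\<le>d div 2. smult (c' k) ([:0, 1:] ^ k * [:1, 1:] ^ (d - 2 * k)))"
    proof -
      have "q = (\<Sum>k\<le>(d - 2) div 2. smult (c k) ([:0, 1:] ^ k * [:1, 1:] ^ (d - 2 - 2 * k)))"
        using c by (simp add: is_gamma_expansion_def)
      then have "[:0, 1:] * q = (\<Sum>k\<le>(d - 2) div 2. smult (c k) ([:0, 1:] ^ Suc k * [:1, 1:] ^ (d - 2 * Suc k)))"
        by (simp add: sum_distrib_left mult.assoc del: mult_pCons_left)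
      then show ?thesis
        unfolding dd sum.atMost_Suc_shift by (simp add: c'_def B_def del: mult_pCons_left)
    qed
    finally have "is_gamma_expansion d f c'"
      using c dd by (auto simp: is_gamma_expansion_def c'_def split: nat.split)
    then show ?thesis by blast
  qed
qed

lemma coeff_eulerian_poly:
  "coeff (eulerian_poly n) k = of_nat (card {p. p permutes {1..n} \<and> des n p = k})"
proof -
  have fin: "finite {p. p permutes {1..n}}" by (simp add: finite_permutations)
  have "coeff (eulerian_poly n) k = (\<Sum>p | p permutes {1..n}. if des n p = k then 1 else 0)"
    by (simp add: eulerian_poly_def coeff_sum)
  also have "\<dots> = of_nat (card {p \<in> {p. p permutes {1..n}}. des n p = k})"
    using fin by (simp add: sum.If_cases Int_def)
  finally show ?thesis by simp
qed

lemma des_le: "des n p \<le> n - 1"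
proof -
  have "card {i \<in> {1..<n}. p i > p (i + 1)} \<le> card {1..<n}" by (rule card_mono) auto
  then show ?thesis by (simp add: des_def)
qed

lemma eulerian_poly_palindromic:
  assumes "k \<le> n - 1"
  shows "coeff (eulerian_poly n) k = coeff (eulerian_poly n) (n - 1 - k)"
proof -
  define r where "r x = (if x \<in> {1..n} then n + 1 - x else x)" for x
  have rr: "r (r x) = x" for x by (auto simp: r_def)
  have r: "r permutes {1..n}"
    unfolding permutes_def using rr by (metis r_def)
  have rp: "r \<circ> p permutes {Suc 0..n}" if "p permutes {Suc 0..n}" for p
    using permutes_compose[OF _ r] that by simp
  have des: "des n (r \<circ> p) = n - 1 - des n p" if p: "p permutes {1..n}" for p
  proof -
    let ?D = "{i \<in> {1..<n}. p i > p (i + 1)}"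
    have "{i \<in> {1..<n}. (r \<circ> p) i > (r \<circ> p) (i + 1)} = {1..<n} - ?D"
    proof -
      have "((r \<circ> p) i > (r \<circ> p) (i + 1)) = (\<not> p i > p (i + 1))" if "i \<in> {1..<n}" for i
      proof -
        have "p i \<in> {1..n}" "p (i + 1) \<in> {1..n}"
          unfolding permutes_in_image[OF p] using that by auto
        moreover have "p i \<noteq> p (i + 1)" using permutes_inj[OF p] by (metis injD n_not_Suc_n Suc_eq_plus1)
        ultimately show ?thesis by (auto simp: r_def)
      qed
      then show ?thesis by blast
    qed
    then have "des n (r \<circ> p) = card ({1..<n} - ?D)" by (simp add: des_def)
    also have "\<dots> = card {1..<n} - card ?D" by (rule card_Diff_subset) auto
    finally show ?thesis by (simp add: des_def)
  qed
  have "bij_betw (\<lambda>p. r \<circ> p) {p. p permutes {1..n} \<and> des n p = k}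
      {p. p permutes {1..n} \<and> des n p = n - 1 - k}"
  proof (rule bij_betw_byWitness[where f' = "\<lambda>p. r \<circ> p"])
    show "(\<lambda>p. r \<circ> p) ` {p. p permutes {1..n} \<and> des n p = n - 1 - k}
        \<subseteq> {p. p permutes {1..n} \<and> des n p = k}"
      using assms by (auto simp: des rp)
  qed (auto simp: rr fun_eq_iff des rp)
  then show ?thesis unfolding coeff_eulerian_poly by (simp add: bij_betw_same_card)
qed

lemma gamma_A_ex1: "\<exists>!c. is_gamma_expansion (n - 1) (eulerian_poly n) c"
proof -
  have "degree (eulerian_poly n) \<le> n - 1"
  proof (rule degree_le, intro allI impI)
    fix i assume "i > n - 1"
    then have "{p. p permutes {1..n} \<and> des n p = i} = {}" using des_le[of n] by (auto simp: not_less[symmetric])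
    then show "coeff (eulerian_poly n) i = 0"
      by (simp only: coeff_eulerian_poly card.empty of_nat_0)
  qed
  then show ?thesis
    using is_gamma_expansion_exists eulerian_poly_palindromic is_gamma_expansion_unique by metis
qed

lemma is_gamma_expansion_gamma_A: "is_gamma_expansion (n - 1) (eulerian_poly n) (gamma_A n)"
  unfolding gamma_A_def by (rule theI'[OF gamma_A_ex1])

end

theory Submission
  imports Defs
begin

text \<open>
  Inserting the letter \<open>n + 1\<close> into the permutations of \<open>{1..n}\<close> gives
  \<open>A\<^sub>n\<^sub>+\<^sub>1 = (1 + n x) A\<^sub>n + x (1 - x) A\<^sub>n'\<close>. The operator on the right-hand side acts on the
  \<open>\<gamma>\<close>-basis \<open>x\<^sup>k (1 + x)\<^sup>m\<^sup>-\<^sup>2\<^sup>k\<close> with \<open>m = n - 1\<close> exactly as \<open>D\<close> acts on the monomials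
  \<open>u\<^sup>k\<^sup>+\<^sup>1 v\<^sup>m\<^sup>-\<^sup>2\<^sup>k\<close>, so both sides of the theorem satisfy the same recurrence.
\<close>

section \<open>The recurrence of the Eulerian polynomials\<close>

text \<open>
  In one-line notation, \<open>p \<circ> last_to n j\<close> is \<open>p\<close> with the letter \<open>n + 1\<close> inserted at position \<open>j\<close>.
\<close>

definition last_to :: "nat \<Rightarrow> nat \<Rightarrow> nat \<Rightarrow> nat" where
  "last_to n j i = (if i < j \<or> i > n + 1 then i else if i = j then n + 1 else i - 1)"

lemma last_to_permutes:
  assumes "j \<in> {1..n+1}"
  shows "last_to n j permutes {1..n+1}"
proof (rule inj_imp_permutes)
  show "inj_on (last_to n j) {1..n+1}"
    using assms by (auto simp: inj_on_def last_to_def split: if_splits)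
qed (use assms in \<open>auto simp: last_to_def split: if_splits\<close>)

text \<open>The letter \<open>n + 1\<close> of \<open>p \<circ> last_to n j\<close> stands at
  position \<open>j\<close>, so \<open>j\<close> can be read off; cancelling the bijection
  \<open>last_to n j\<close> then recovers \<open>p\<close>.\<close>

lemma inj_on_insert_last:
  "inj_on (\<lambda>(p, j). p \<circ> last_to n j) ({p. p permutes {1..n}} \<times> {1..n+1})"
proof (rule inj_onI, clarsimp)
  fix p q j k
  assume p: "p permutes {Suc 0..n}" and q: "q permutes {Suc 0..n}"
    and j: "Suc 0 \<le> j" "j \<le> Suc n" and k: "Suc 0 \<le> k" "k \<le> Suc n"
    and eq: "p \<circ> last_to n j = q \<circ> last_to n k"
  have pn: "p (n + 1) = n + 1" and qn: "q (n + 1) = n + 1"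
    using p q by (auto simp: permutes_def)
  have lj: "last_to n j j = n + 1" and lk: "last_to n k k = n + 1"
    using j k by (auto simp: last_to_def)
  have permk: "last_to n k permutes {1..n+1}"
    using k by (intro last_to_permutes) auto
  have "q (last_to n k j) = q (last_to n k k)"
    using fun_cong[OF eq, of j] pn qn lj lk by simp
  then have jk: "j = k"
    using permutes_inj[OF q] permutes_inj[OF permk] by (auto dest: injD)
  have "p = q"
    using eq permutes_surj[OF permk] unfolding jk by (metis fun_eq_iff comp_apply surjD)
  with jk show "p = q \<and> j = k" by simp
qed

text \<open>Inclusion together with injectivity suffices, because both sides have cardinality (n +
  1)!.\<close>

lemma insert_last_image:
  "(\<lambda>(p, j). p \<circ> last_to n j) ` ({p. p permutes {1..n}} \<times> {1..n+1}) = {p. p permutes {1..n+1}}"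
proof (rule card_subset_eq)
  show "(\<lambda>(p, j). p \<circ> last_to n j) ` ({p. p permutes {1..n}} \<times> {1..n+1}) \<subseteq> {p. p permutes {1..n+1}}"
  proof clarify
    fix p j assume p: "p permutes {1..n}" and j: "j \<in> {1..n+1}"
    have "p permutes {1..n+1}" by (rule permutes_subset[OF p]) simp
    then show "p \<circ> last_to n j permutes {1..n+1}"
      by (rule permutes_compose[OF last_to_permutes[OF j]])
  qed
  show "card ((\<lambda>(p, j). p \<circ> last_to n j) ` ({p. p permutes {1..n}} \<times> {1..n+1})) =
      card {p. p permutes {1..n+1}}"
    unfolding card_image[OF inj_on_insert_last]
    by (simp add: card_cartesian_product card_permutations[OF refl])
qed (simp add: finite_permutations)

section \<open>Descents under insertion of the largest letter\<close>

lemma permutes_atLeastAtMost_outside: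
  assumes "p permutes {1..n::nat}"
  shows "p 0 = 0" "p (Suc n) = Suc n" "i \<in> {1..n} \<Longrightarrow> p i \<le> n"
  using assms permutes_in_image[OF assms, of i] by (auto simp: permutes_def)

text \<open>The new maximum is a descent unless it comes last. Inserted inside a descent it breaks
  that descent and replaces it, inserted at the end it changes nothing, and anywhere else it adds
  one descent. For \<open>j = 1\<close> the value \<open>j - 1 = 0\<close> is never a
  descent.\<close>

lemma des_insert_last:
  assumes p: "p permutes {1..n}" and j: "j \<in> {1..n+1}"
  shows "des (n + 1) (p \<circ> last_to n j) =
    (if j = n + 1 \<or> j - 1 \<in> {i \<in> {1..<n}. p i > p (i + 1)} then des n p else des n p + 1)"
proof -
  define D where "D = {i \<in> {1..<n}. p i > p (i + 1)}"
  define S where "S = {i \<in> {1..<n+1}. (p \<circ> last_to n j) i > (p \<circ> last_to n j) (i + 1)}"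
  note out = permutes_atLeastAtMost_outside[OF p]
  have finD: "finite D" by (simp add: D_def)
  show ?thesis
  proof (cases "j = n + 1")
    case True
    have "S = D"
    proof (rule set_eqI)
      fix i
      show "i \<in> S \<longleftrightarrow> i \<in> D"
        using True out(2) out(3)[of i]
        by (cases "i < n"; cases "i = n") (auto simp: S_def D_def last_to_def)
    qed
    then show ?thesis using True by (simp add: des_def S_def D_def)
  next
    case False
    \<comment> \<open>The surviving descents at or after \<open>j\<close> move one place to the
      right; the one at \<open>j - 1\<close>, if present, is lost to the ascent into the new
      maximum.\<close>
    define f where "f i = (if i < j then i else i + 1)" for i
    have jn: "1 \<le> j" "j \<le> n" using j False by auto
    have "0 \<notin> D" by (simp add: D_def)
    have "S = insert j (f ` (D - {j - 1}))"
    proof (rule set_eqI)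
      fix i
      consider "i = j" | "i = j - 1" "i < j" | "i + 1 < j" | "i > j" "i \<le> n" | "i > n" "i > j"
        by linarith
      then show "i \<in> S \<longleftrightarrow> i \<in> insert j (f ` (D - {j - 1}))"
      proof cases
        case 1
        then show ?thesis
          using jn out(2) out(3)[of i] by (auto simp: S_def last_to_def)
      next
        case 2
        then show ?thesis
          using jn out(2) out(3)[of i] by (auto simp: S_def last_to_def f_def split: if_splits)
      next
        case 3
        then have "i \<in> f ` (D - {j - 1}) \<longleftrightarrow> i \<in> D"
          by (auto simp: f_def image_iff)
        with 3 show ?thesis
          using jn by (auto simp: S_def D_def last_to_def)
      next
        case 4
        then have "i \<in> f ` (D - {j - 1}) \<longleftrightarrow> i - 1 \<in> D"
          using \<open>0 \<notin> D\<close> by (auto simp: f_def image_iff intro!: bexI[of _ "i - 1"])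
        with 4 show ?thesis
          using jn by (auto simp: S_def D_def last_to_def)
      next
        case 5
        then show ?thesis
          by (auto simp: S_def D_def f_def)
      qed
    qed
    moreover have "j \<notin> f ` (D - {j - 1})" by (auto simp: f_def)
    moreover have "inj_on f (D - {j - 1})" by (auto simp: inj_on_def f_def split: if_splits)
    ultimately have "card S = Suc (card (D - {j - 1}))"
      using finD by (simp add: card_image)
    also have "\<dots> = (if j - 1 \<in> D then card D else card D + 1)"
      using finD by (simp add: card_Suc_Diff1 del: card_Diff_insert)
    finally show ?thesis using False by (simp only: des_def S_def D_def simp_thms)
  qed
qed

lemma sum_insert_last:
  fixes p :: "nat \<Rightarrow> nat"
  assumes p: "p permutes {1..n}"
  shows "(\<Sum>j\<in>{1..n+1}. monom (1::rat) (des (n + 1) (p \<circ> last_to n j))) =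
    monom (of_nat (des n p) + 1) (des n p) + monom (of_nat n - of_nat (des n p)) (des n p + 1)"
proof -
  define D where "D = {i \<in> {1..<n}. p i > p (i + 1)}"
  define d where "d = des n p"
  have cD: "card D = d" by (simp add: D_def d_def des_def)
  have fin: "finite D" by (simp add: D_def)
  \<comment> \<open>The \<open>d + 1\<close> positions of \<open>J\<close> preserve the number of
    descents; the other \<open>n - d\<close> raise it by one.\<close>
  define J where "J = insert (n + 1) (Suc ` D)"
  have J: "J \<subseteq> {1..n+1}" by (auto simp: J_def D_def)
  have "n + 1 \<notin> Suc ` D" by (auto simp: D_def)
  then have cJ: "card J = d + 1" using fin cD by (simp add: J_def card_image)
  have "card ({1..n+1} - J) = n - d"
    using J by (simp add: card_Diff_subset finite_subset[OF J] cJ)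
  moreover have "d \<le> n" using des_le[of n p] by (simp add: d_def)
  ultimately have cJ': "of_nat (card ({1..n+1} - J)) = (of_nat n - of_nat d :: rat)"
    by (simp add: of_nat_diff)
  have mem: "j = n + 1 \<or> j - 1 \<in> D \<longleftrightarrow> j \<in> J" if "j \<in> {1..n+1}" for j
    using that by (cases j) (auto simp: J_def)
  have "(\<Sum>j\<in>{1..n+1}. monom (1::rat) (des (n + 1) (p \<circ> last_to n j))) =
      (\<Sum>j\<in>{1..n+1}. if j \<in> J then monom 1 d else monom 1 (d + 1))"
    by (rule sum.cong[OF refl])
      (simp only: des_insert_last[OF p] mem flip: D_def d_def, simp)
  also have "\<dots> = (\<Sum>j\<in>J. monom 1 d) + (\<Sum>j\<in>{1..n+1} - J. monom 1 (d + 1))"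
    using J by (subst sum.If_cases) (simp_all only: finite_atLeastAtMost Collect_mem_eq Diff_eq Int_absorb1)
  also have "\<dots> = monom (of_nat (card J)) d + monom (of_nat (card ({1..n+1} - J))) (d + 1)"
    by (simp only: sum_constant of_nat_monom mult_monom) simp
  finally show ?thesis by (simp only: cJ cJ' of_nat_add of_nat_1 d_def)
qed

section \<open>The recurrence as a linear differential operator\<close>

definition eulerian_step :: "nat \<Rightarrow> rat poly \<Rightarrow> rat poly" where
  "eulerian_step n f = [:1, of_nat n:] * f + [:0, 1:] * ([:1, -1:] * pderiv f)"

lemma eulerian_step_0: "eulerian_step n 0 = 0"
  by (simp add: eulerian_step_def)

lemma eulerian_step_add: "eulerian_step n (f + g) = eulerian_step n f + eulerian_step n g"
  by (simp add: eulerian_step_def pderiv_add smult_add_right algebra_simps)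

lemma eulerian_step_smult: "eulerian_step n (smult c f) = smult c (eulerian_step n f)"
  by (simp add: eulerian_step_def pderiv_smult smult_add_right)

lemma eulerian_step_sum: "eulerian_step n (\<Sum>i\<in>I. f i) = (\<Sum>i\<in>I. eulerian_step n (f i))"
  by (induction I rule: infinite_finite_induct) (simp_all add: eulerian_step_0 eulerian_step_add)

text \<open>The coefficients are the counts of \<open>sum_insert_last\<close>: on a monomial the
  operator performs the insertion of a letter.\<close>

lemma eulerian_step_monom:
  "eulerian_step n (monom 1 d) = monom (of_nat d + 1) d + monom (of_nat n - of_nat d) (d + 1)"
proof (rule poly_eqI)
  fix i
  show "coeff (eulerian_step n (monom 1 d)) i =
      coeff (monom (of_nat d + 1) d + monom (of_nat n - of_nat d) (d + 1)) i"
    by (cases d) (auto simp: eulerian_step_def pderiv_monom coeff_pCons algebra_simps split: nat.splits)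
qed

text \<open>Group the permutations of \<open>{1..n+1}\<close> by the permutation of
  \<open>{1..n}\<close> left after deleting the largest letter; each group contributes one operator
  image, and linearity sums them.\<close>

lemma eulerian_poly_Suc: "eulerian_poly (n + 1) = eulerian_step n (eulerian_poly n)"
proof -
  have "eulerian_poly (n + 1) =
      (\<Sum>(p, j)\<in>{p. p permutes {1..n}} \<times> {1..n+1}. monom 1 (des (n + 1) (p \<circ> last_to n j)))"
    unfolding eulerian_poly_def insert_last_image[of n, symmetric] sum.reindex[OF inj_on_insert_last]
    by (simp add: case_prod_unfold o_def)
  also have "\<dots> = (\<Sum>p | p permutes {1..n}. \<Sum>j\<in>{1..n+1}. monom 1 (des (n + 1) (p \<circ> last_to n j)))"
    by (rule sum.cartesian_product[symmetric])
  also have "\<dots> = (\<Sum>p | p permutes {1..n}. eulerian_step n (monom 1 (des n p)))"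
    by (rule sum.cong[OF refl]) (simp only: sum_insert_last eulerian_step_monom mem_Collect_eq)
  finally show ?thesis by (simp add: eulerian_poly_def eulerian_step_sum)
qed

section \<open>The recurrence of the gamma vector\<close>

text \<open>Here \<open>m\<close> is the degree of the expansion with coefficients \<open>c\<close>.
  Index \<open>k\<close> receives a contribution from \<open>k\<close> itself and one from
  \<open>k - 1\<close>. The subtraction truncates only for \<open>j\<close> beyond
  \<open>m div 2\<close>, where the coefficients of an expansion vanish.\<close>

definition gamma_step :: "nat \<Rightarrow> (nat \<Rightarrow> rat) \<Rightarrow> nat \<Rightarrow> rat" where
  "gamma_step m c k = of_nat (k + 1) * c k +
     (case k of 0 \<Rightarrow> 0 | Suc j \<Rightarrow> of_nat (2 * (m - 2 * j)) * c j)"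

text \<open>
  The homomorphism \<open>h\<close> embeds the scalars into either of the two polynomial rings.
\<close>

lemma sum_gamma_step:
  fixes h :: "rat \<Rightarrow> 'a::comm_ring_1"
  assumes h_add: "\<And>a b. h (a + b) = h a + h b" and h_mult: "\<And>a b. h (a * b) = h a * h b"
    and h_1: "h 1 = 1"
    and c: "\<And>k. k > m div 2 \<Longrightarrow> c k = 0"
  shows "(\<Sum>k\<le>m div 2. h (c k) * (of_nat (k + 1) * T k + of_nat (2 * (m - 2 * k)) * T (Suc k))) =
    (\<Sum>k\<le>Suc m div 2. h (gamma_step m c k) * T k)"
proof -
  let ?M = "m div 2"
  have h_0: "h 0 = 0" using h_add[of 0 0] by simp
  have h_nat: "h (of_nat n) = of_nat n" for n
    by (induction n) (simp_all add: h_0 h_1 h_add)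
  have h_case: "h (case k of 0 \<Rightarrow> 0 | Suc j \<Rightarrow> g j) = (case k of 0 \<Rightarrow> 0 | Suc j \<Rightarrow> h (g j))" for k g
    by (simp add: h_0 split: nat.split)
  \<comment> \<open>The ranges differ only for even \<open>m\<close>; the extra term vanishes since
    \<open>c (Suc ?M) = 0\<close> and the factor \<open>m - 2 * ?M\<close> is 0.\<close>
  have "(\<Sum>k\<le>Suc m div 2. h (gamma_step m c k) * T k) = (\<Sum>k\<le>Suc ?M. h (gamma_step m c k) * T k)"
  proof (rule sum.mono_neutral_left)
    show "\<forall>k\<in>{..Suc ?M} - {..Suc m div 2}. h (gamma_step m c k) * T k = 0"
    proof
      fix k assume "k \<in> {..Suc ?M} - {..Suc m div 2}"
      then have k: "k = Suc ?M" and "m = 2 * ?M" by auto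
      then show "h (gamma_step m c k) * T k = 0"
        by (simp add: gamma_step_def c h_0)
    qed
  qed auto
  also have "\<dots> = (\<Sum>k\<le>Suc ?M. h (c k) * (of_nat (k + 1) * T k)) +
      (\<Sum>k\<le>Suc ?M. (case k of 0 \<Rightarrow> 0 | Suc j \<Rightarrow> of_nat (2 * (m - 2 * j)) * h (c j)) * T k)"
    unfolding gamma_step_def h_add h_mult h_nat h_case distrib_right sum.distrib by (simp only: mult_ac)
  also have "(\<Sum>k\<le>Suc ?M. h (c k) * (of_nat (k + 1) * T k)) =
      (\<Sum>k\<le>?M. h (c k) * (of_nat (k + 1) * T k))"
    by (simp add: c h_0)
  also have "(\<Sum>k\<le>Suc ?M. (case k of 0 \<Rightarrow> 0 | Suc j \<Rightarrow> of_nat (2 * (m - 2 * j)) * h (c j)) * T k) =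
      (\<Sum>k\<le>?M. h (c k) * (of_nat (2 * (m - 2 * k)) * T (Suc k)))"
    unfolding sum.atMost_Suc_shift by (simp add: mult_ac)
  finally show ?thesis by (simp only: sum.distrib distrib_left)
qed

text \<open>With l = m - 2k, after division by x^k (1+x)^(l-1) this is the identity (1 + (m+1)x +
  k(1-x))(1+x) + l x(1-x) = (k+1)(1+x)^2 + 2l x.\<close>

lemma eulerian_step_gamma_basis:
  assumes "2 * k \<le> m"
  shows "eulerian_step (m + 1) ([:0, 1:] ^ k * [:1, 1:] ^ (m - 2 * k)) =
    of_nat (k + 1) * ([:0, 1:] ^ k * [:1, 1:] ^ (Suc m - 2 * k)) +
    of_nat (2 * (m - 2 * k)) * ([:0, 1:] ^ Suc k * [:1, 1:] ^ (Suc m - 2 * Suc k))"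
proof -
  define X Y :: "rat poly" where "X = [:0, 1:]" and "Y = [:1, 1:]"
  have Y: "Y = 1 + X" by (simp add: X_def Y_def one_pCons)
  obtain l where m: "m = 2 * k + l" using assms le_Suc_ex by blast
  have lin: "[:1, of_nat n:] = 1 + of_nat n * X" for n
    by (simp add: X_def of_nat_poly one_pCons)
  have lin': "[:1, -1:] = 1 - X"
    by (simp add: X_def one_pCons)
  have dX: "pderiv X = 1" and dY: "pderiv Y = 1"
    by (simp_all add: X_def Y_def pderiv_pCons)
  \<comment> \<open>The factor \<open>X\<close> restores the exponent \<open>k\<close>, so that
    \<open>k = 0\<close> needs no separate treatment later.\<close>
  have dXk: "X * pderiv (X ^ k) = of_nat k * X ^ k"
    by (cases k) (simp_all only: pderiv_power_Suc dX, simp_all add: of_nat_poly)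
  have lead: "eulerian_step (m + 1) (X ^ k * Y ^ l) = (1 + of_nat (m + 1) * X) * (X ^ k * Y ^ l) +
      (1 - X) * ((X * pderiv (X ^ k)) * Y ^ l + X * X ^ k * pderiv (Y ^ l))"
    unfolding eulerian_step_def lin lin' pderiv_mult X_def[symmetric] by (simp only: algebra_simps)
  \<comment> \<open>For \<open>l = 0\<close> the truncated exponent \<open>l - 1\<close> is
    harmless, as its coefficient is 0.\<close>
  have "eulerian_step (m + 1) (X ^ k * Y ^ l) =
    of_nat (k + 1) * (X ^ k * Y ^ Suc l) + of_nat (2 * l) * (X ^ Suc k * Y ^ (l - 1))"
  proof (cases l)
    case 0
    then show ?thesis unfolding lead dXk by (simp add: m Y algebra_simps)
  next
    case (Suc r)
    have dYl: "pderiv (Y ^ l) = of_nat l * Y ^ r"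
      unfolding Suc pderiv_power_Suc dY by (simp add: of_nat_poly)
    \<comment> \<open>Naming the powers keeps \<open>Y ^ r\<close> closed when \<open>Y\<close> is
      replaced by \<open>1 + X\<close>.\<close>
    define P where "P = X ^ k"
    define Q where "Q = Y ^ r"
    have "(1 + of_nat (m + 1) * X) * (P * (Y * Q)) + (1 - X) * (of_nat k * P * (Y * Q) + X * P * (of_nat l * Q)) =
       of_nat (k + 1) * (P * (Y * (Y * Q))) + of_nat (2 * l) * (X * P * Q)"
      unfolding Y by (simp add: m algebra_simps)
    then show ?thesis unfolding lead dXk dYl P_def Q_def by (simp add: Suc)
  qed
  then show ?thesis by (simp add: m X_def Y_def)
qed

lemma is_gamma_expansion_step:
  assumes "is_gamma_expansion m f c"
  shows "is_gamma_expansion (Suc m) (eulerian_step (m + 1) f) (gamma_step m c)"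
proof -
  have f: "f = (\<Sum>k\<le>m div 2. smult (c k) ([:0, 1:] ^ k * [:1, 1:] ^ (m - 2 * k)))"
    and c: "\<And>k. k > m div 2 \<Longrightarrow> c k = 0"
    using assms by (auto simp: is_gamma_expansion_def)
  define T :: "nat \<Rightarrow> rat poly" where "T k = [:0, 1:] ^ k * [:1, 1:] ^ (Suc m - 2 * k)" for k
  have "eulerian_step (m + 1) f =
      (\<Sum>k\<le>m div 2. [:c k:] * (of_nat (k + 1) * T k + of_nat (2 * (m - 2 * k)) * T (Suc k)))"
    unfolding f eulerian_step_sum eulerian_step_smult T_def
    by (rule sum.cong[OF refl], subst eulerian_step_gamma_basis) auto
  also have "\<dots> = (\<Sum>k\<le>Suc m div 2. [:gamma_step m c k:] * T k)"
    by (rule sum_gamma_step) (use c in \<open>auto simp: one_pCons\<close>)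
  finally have "eulerian_step (m + 1) f = (\<Sum>k\<le>Suc m div 2. smult (gamma_step m c k) (T k))"
    by simp
  moreover have "gamma_step m c k = 0" if "k > Suc m div 2" for k
    using that c[of k] c[of "k - 1"] by (cases k) (auto simp: gamma_step_def)
  ultimately show ?thesis by (simp only: is_gamma_expansion_def T_def) blast
qed

text \<open>Both sides are gamma expansions of the same Eulerian polynomial in degree
  \<open>Suc m\<close>, so uniqueness identifies them.\<close>

lemma gamma_A_Suc: "gamma_A (Suc (Suc m)) = gamma_step m (gamma_A (Suc m))"
  using is_gamma_expansion_step[of m "eulerian_poly (Suc m)"] is_gamma_expansion_gamma_A[of "Suc m"]
    is_gamma_expansion_gamma_A[of "Suc (Suc m)"] eulerian_poly_Suc[of "Suc m"]
  by (auto intro: is_gamma_expansion_unique)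

lemma gamma_A_1: "gamma_A 1 0 = 1"
proof -
  have "eulerian_poly 1 = 1" by (simp add: eulerian_poly_def des_def)
  then have "smult (gamma_A 1 0) 1 = 1"
    using is_gamma_expansion_gamma_A[of 1] by (simp add: is_gamma_expansion_def)
  then show ?thesis by (simp add: one_pCons)
qed

lemma gamma_A_eq_0: "k > m div 2 \<Longrightarrow> gamma_A (Suc m) k = 0"
  using is_gamma_expansion_gamma_A[of "Suc m"] by (simp add: is_gamma_expansion_def)

section \<open>The derivation of the grammar\<close>

lemma cst_add: "cst (a + b) = cst a + cst b"
  by (simp add: cst_def single_add)

lemma cst_mult: "cst (a * b) = cst a * cst b"
  by (simp add: cst_def mult_single)

lemma cst_1: "cst 1 = 1"
  by (simp add: cst_def)

context
  fixes g :: "'x \<Rightarrow> 'x qpoly" and D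
  assumes D: "is_formal_derivative g D"
begin

lemma formal_derivative_add: "D (p + q) = D p + D q"
  and formal_derivative_cst_mult: "D (cst c * p) = cst c * D p"
  and formal_derivative_mult: "D (p * q) = D p * q + p * D q"
  and formal_derivative_indet: "D (indet x) = g x"
  using D unfolding is_formal_derivative_def by blast+

lemma formal_derivative_sum: "D (\<Sum>i\<in>I. f i) = (\<Sum>i\<in>I. D (f i))"
proof -
  have "D 0 = 0" using formal_derivative_add[of 0 0] by simp
  then show ?thesis
    by (induction I rule: infinite_finite_induct) (simp_all add: formal_derivative_add)
qed

lemma formal_derivative_power: "D (p ^ n) = of_nat n * p ^ (n - 1) * D p"
proof (induction n)
  case 0
  show ?case using formal_derivative_mult[of 1 1] by simp
next
  case (Suc n)
  have "D (p ^ Suc n) = D p * p ^ n + p * D (p ^ n)"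
    by (simp add: formal_derivative_mult)
  then show ?case unfolding Suc.IH by (cases n) (simp_all add: algebra_simps)
qed

end

text \<open>Differentiating a factor u keeps the power of u and adds a v; differentiating a factor v
  trades it for 2u. The coefficients agree with those of
  \<open>eulerian_step_gamma_basis\<close>.\<close>

lemma grammar_derivative_monomial:
  assumes D: "is_formal_derivative grammar_G D" and "2 * k \<le> m"
  shows "D (indet U ^ (k + 1) * indet V ^ (m - 2 * k)) =
    of_nat (k + 1) * (indet U ^ (k + 1) * indet V ^ (Suc m - 2 * k)) +
    of_nat (2 * (m - 2 * k)) * (indet U ^ (Suc k + 1) * indet V ^ (Suc m - 2 * Suc k))"
proof -
  obtain l where m: "m = 2 * k + l" using assms(2) le_Suc_ex by blast
  have two: "cst 2 = (2 :: uv qpoly)" using cst_add[of 1 1] by (simp add: cst_1)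
  have DU: "D (indet U) = indet U * indet V" and DV: "D (indet V) = 2 * indet U"
    by (simp_all add: formal_derivative_indet[OF D] two)
  show ?thesis
    unfolding m formal_derivative_mult[OF D] formal_derivative_power[OF D] DU DV
    by (cases l) (simp_all add: algebra_simps)
qed

theorem theorem10:
  fixes n :: nat
  shows "(formal_derivative grammar_G ^^ n) (indet U) =
    (\<Sum>k = 0..n div 2. cst (gamma_A (n + 1) k) * indet U ^ (k + 1) * indet V ^ (n - 2 * k))"
proof -
  define D where "D = formal_derivative grammar_G"
  have D: "is_formal_derivative grammar_G D"
    unfolding D_def by (rule is_formal_derivative_formal_derivative)
  \<comment> \<open>The degree \<open>n\<close> goes with \<open>gamma_A (Suc n)\<close>, since
    \<open>eulerian_poly (Suc n)\<close> is expanded in degree \<open>n\<close>.\<close>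
  define T where "T m k = indet U ^ (k + 1) * indet V ^ (m - 2 * k)" for m k
  have "(D ^^ n) (indet U) = (\<Sum>k\<le>n div 2. cst (gamma_A (Suc n) k) * T n k)"
  proof (induction n)
    case 0
    then show ?case using gamma_A_1 by (simp add: T_def cst_1)
  next
    case (Suc n)
    have "(D ^^ Suc n) (indet U) = (\<Sum>k\<le>n div 2. cst (gamma_A (Suc n) k) * D (T n k))"
      by (simp add: Suc.IH formal_derivative_sum[OF D] formal_derivative_cst_mult[OF D])
    also have "\<dots> = (\<Sum>k\<le>n div 2. cst (gamma_A (Suc n) k) *
        (of_nat (k + 1) * T (Suc n) k + of_nat (2 * (n - 2 * k)) * T (Suc n) (Suc k)))"
      unfolding T_def by (rule sum.cong[OF refl], subst grammar_derivative_monomial[OF D]) auto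
    also have "\<dots> = (\<Sum>k\<le>Suc n div 2. cst (gamma_step n (gamma_A (Suc n)) k) * T (Suc n) k)"
      \<comment> \<open>The regrouping used for the Eulerian polynomials applies again, now with
        \<open>cst\<close> as the embedding of scalars.\<close>
      by (rule sum_gamma_step) (auto simp: cst_add cst_mult cst_1 gamma_A_eq_0)
    finally show ?case by (simp only: gamma_A_Suc)
  qed
  then show ?thesis
    by (simp add: T_def D_def atLeast0AtMost mult.assoc)
qed

end
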